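(* Let $\delta>0$, $r>0$, $z\in Z$ and let $\Xi'_N=\mathrm{supp}(P'_N)$. The optimal value of the dual problem $$\inf\ \ \beta r-\int_{\Xi'}v(\xi')\,dP'_N(\xi')+\gamma(\delta-1)+\max_{\xi\in\Xi}\left[\ell(z,\xi)+\beta\int_{\Xi'}\exp\left(\frac{u(\xi')}{\beta}-1\right)dO_\xi(\xi')\right]$$ over $\beta\ge0$, $u:\Xi'\to\mathbb R$, $v:\Xi'_N\to\mathbb R$, $\gamma\ge0$ subject to $\gamma\,\mathbb 1\{\|\xi'-\xi'_i\|\le\delta\}+v(\xi'_i)\le u(\xi')$ for all $\xi'\in\Xi'$, $\xi'_i\in\Xi'_N$, is equal to the optimal value of the following problem, which is convex in $(\beta,v,\gamma)$: $$\inf\ \ \beta r-\sum_{j=1}^{J(v)}v(\xi'_{[j]}(v))\,P'_N(\xi'_{[j]}(v))+\gamma(\delta-1)+\max_{\xi\in\Xi}\Big[\ell(z,\xi)+\sum_{j=1}^{J(v)}O_\xi(\Xi'_j(v))\,\frac{\beta}{e}\exp\Big(\frac{\max(v(\xi'_{[1]}(v)),\,v(\xi'_{[j]}(v))+\gamma)}{\beta}\Big)+O_\xi(\Xi'_{J(v)+1}(v))\,\frac{\beta}{e}\exp\Big(\frac{v(\xi'_{[1]}(v))}{\beta}\Big)\Big]$$ over $\beta\ge0$, $v:\Xi'_N\to\mathbb R$, $\gamma\ge0$.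
   Context: $\Xi,\Xi'$ are Polish spaces, the distance on $\Xi'$ being written $\|s-s'\|$. $\ell:Z\times\Xi\to\mathbb R$ is a loss function, $O:\Xi\to\mathcal P(\Xi')$ is an observational model (Markov kernel into Borel probability measures on $\Xi'$), and $P'_N=\frac1N\sum_{i=1}^N\delta_{\xi'_i}$ is the empirical measure of noisy observations in $\Xi'$, so $\Xi'_N$ is finite. The functions $u$ are measurable; $\max_{\xi\in\Xi}$ is read as a supremum if not attained. For $v:\Xi'_N\to\mathbb R$, let $J(v)=|\{v(\xi'):\xi'\in\Xi'_N\}|$ be the number of distinct values of $v$. Let $\xi'_{[1]}(v),\dots,\xi'_{[J(v)]}(v)$ be the partition of $\Xi'_N$ into the sets on which $v$ is constant, ordered so that $v$ is non-increasing in the index: $v(\tilde\xi')\ge v(\hat\xi')$ for $\tilde\xi'\in\xi'_{[j]}(v)$, $\hat\xi'\in\xi'_{[j']}(v)$, $j<j'$. Here $v(\xi'_{[j]}(v))$ denotes the common value of $v$ on $\xi'_{[j]}(v)$, and $P'_N(\xi'_{[j]}(v))$ the mass of this set. The event set $\Xi'$ is partitioned by $\Xi'_0(v)=\emptyset$, $$\Xi'_j(v)=\Big\{\xi'\in\Xi':\min_{\tilde\xi'\in\xi'_{[j]}(v)}\|\xi'-\tilde\xi'\|\le\delta\Big\}\setminus\bigcup_{l=1}^{j-1}\Xi'_l(v),\quad j=1,\dots,J(v),\qquad \Xi'_{J(v)+1}(v)=\Xi'\setminus\bigcup_{l=1}^{J(v)}\Xi'_l(v).$$ Convention at $\beta=0$: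 $\beta\exp(a/\beta-1)=\frac{\beta}{e}\exp(a/\beta)$ is understood as its limit when $\beta\downarrow0$, i.e. $0$ if $a\le0$ and $+\infty$ if $a>0$. *)

theory Defs
  imports "HOL-Probability.Probability" "HOL-Real_Asymp.Real_Asymp"
begin

definition empirical_measure :: "nat \<Rightarrow> (nat \<Rightarrow> 'y) \<Rightarrow> 'y::topological_space measure" where
  "empirical_measure N xi =
     measure_of UNIV (sets borel) (\<lambda>A. (\<Sum>i=1..N. emeasure (return borel (xi i)) A) / of_nat N)"

lemma emeasure_empirical_measure:
  assumes "A \<in> sets borel"
  shows "emeasure (empirical_measure N xi) A =
           (\<Sum>i=1..N. emeasure (return borel (xi i)) A) / of_nat N"
proof -
  let ?\<mu> = "\<lambda>A. (\<Sum>i=1..N. emeasure (return borel (xi i)) A) / of_nat N"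
  have "countably_additive (sets borel) ?\<mu>"
  proof (rule countably_additiveI)
    fix B :: "nat \<Rightarrow> 'a set"
    assume B: "range B \<subseteq> sets borel" "disjoint_family B"
    have "(\<Sum>k. ?\<mu> (B k)) = (\<Sum>k. \<Sum>i=1..N. emeasure (return borel (xi i)) (B k)) / of_nat N"
      by (simp add: divide_ennreal_def)
    also have "(\<Sum>k. \<Sum>i=1..N. emeasure (return borel (xi i)) (B k)) =
        (\<Sum>i=1..N. \<Sum>k. emeasure (return borel (xi i)) (B k))"
      by (intro suminf_sum) auto
    also have "\<dots> = (\<Sum>i=1..N. emeasure (return borel (xi i)) (\<Union>k. B k))"
      using B by (intro sum.cong refl suminf_emeasure) auto
    finally show "(\<Sum>k. ?\<mu> (B k)) = ?\<mu> (\<Union>k. B k)" .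
  qed
  moreover have "positive (sets borel) ?\<mu>"
    by (simp add: positive_def)
  moreover have "sigma_sets UNIV (sets borel) = sets (borel :: 'a measure)"
    using sets.sigma_sets_eq[of "borel :: 'a measure"] by simp
  ultimately show ?thesis
    using assms
    by (intro emeasure_measure_of[OF empirical_measure_def]) (auto simp: empirical_measure_def)
qed

definition measure_support :: "'y::topological_space measure \<Rightarrow> 'y set" where
  "measure_support M = {s. \<forall>U. open U \<and> s \<in> U \<longrightarrow> 0 < emeasure M U}"

lemma measure_support_empirical_measure:
  fixes xi :: "nat \<Rightarrow> 'y::t1_space"
  shows "measure_support (empirical_measure N xi) = xi ` {1..N}"
proof -
  have pos: "0 < emeasure (empirical_measure N xi) U \<longleftrightarrow> (\<exists>i\<in>{1..N}. xi i \<in> U)" if "open U" for U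
    using that by (auto simp: emeasure_empirical_measure zero_less_iff_neq_zero indicator_def
        ennreal_divide_eq_0_iff sum_eq_0_iff)
  show ?thesis
  proof (intro equalityI subsetI)
    fix s assume s: "s \<in> measure_support (empirical_measure N xi)"
    show "s \<in> xi ` {1..N}"
    proof (rule ccontr)
      assume "s \<notin> xi ` {1..N}"
      moreover have "open (- (xi ` {1..N}))"
        by (simp add: finite_imp_closed open_Compl)
      ultimately show False
        using s pos[of "- (xi ` {1..N})"] unfolding measure_support_def by blast
    qed
  qed (auto simp: measure_support_def pos)
qed

(* The map (beta, a) |-> beta exp (a / beta - 1) for beta \<ge> 0; the value at beta = 0 is the limit
   from the right (scaled_exp_tendsto below). It is ennreal-valued, so that a null set contributes
   0 * \<infinity> = 0, in agreement with the integral. *)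
definition scaled_exp :: "real \<Rightarrow> real \<Rightarrow> ennreal" where
  "scaled_exp \<beta> a =
     (if \<beta> = 0 then (if a \<le> 0 then 0 else \<infinity>) else ennreal (\<beta> * exp (a / \<beta> - 1)))"

lemma scaled_exp_alt:
  "\<beta> \<noteq> 0 \<Longrightarrow> scaled_exp \<beta> a = ennreal (\<beta> / exp 1 * exp (a / \<beta>))"
  by (simp add: scaled_exp_def exp_diff)

lemma scaled_exp_tendsto: "((\<lambda>\<beta>. scaled_exp \<beta> a) \<longlongrightarrow> scaled_exp 0 a) (at_right 0)"
proof -
  have eq: "\<forall>\<^sub>F \<beta> in at_right 0. ennreal (\<beta> * exp (a / \<beta> - 1)) = scaled_exp \<beta> a"
    by (auto simp: scaled_exp_def eventually_at_filter)
  have "((\<lambda>\<beta>. ennreal (\<beta> * exp (a / \<beta> - 1))) \<longlongrightarrow> scaled_exp 0 a) (at_right 0)"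
  proof (cases "a \<le> 0")
    case True
    have "((\<lambda>\<beta>. \<beta> * exp (a / \<beta> - 1)) \<longlongrightarrow> 0) (at_right 0)"
    proof (cases "a = 0")
      case True
      then show ?thesis by simp real_asymp
    next
      case False
      with \<open>a \<le> 0\<close> have "a < 0" by simp
      then show ?thesis by real_asymp
    qed
    from tendsto_ennrealI[OF this] True show ?thesis
      by (simp add: scaled_exp_def)
  next
    case False
    then have "a > 0" by simp
    then have "filterlim (\<lambda>\<beta>. \<beta> * exp (a / \<beta> - 1)) at_top (at_right 0)"
      by real_asymp
    with False show ?thesis
      by (simp add: scaled_exp_def ennreal_tendsto_top_eq_at_top)
  qed
  then show ?thesis
    using eq by (simp cong: tendsto_cong)
qed


text \<open>Decision functions on the finite set \<open>S\<close> are represented by total functions; only their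
  values on \<open>S\<close> enter anywhere below. Blocks are numbered from 1.\<close>

definition num_levels :: "'y set \<Rightarrow> ('y \<Rightarrow> real) \<Rightarrow> nat" where
  "num_levels S v = card (v ` S)"

definition level :: "'y set \<Rightarrow> ('y \<Rightarrow> real) \<Rightarrow> nat \<Rightarrow> real" where
  "level S v j = rev (sorted_list_of_set (v ` S)) ! (j - 1)"

definition block :: "'y set \<Rightarrow> ('y \<Rightarrow> real) \<Rightarrow> nat \<Rightarrow> 'y set" where
  "block S v j = {s \<in> S. v s = level S v j}"

(* For j = num_levels S v + 1 this is the complement of all the previous cells. *)
function cell :: "real \<Rightarrow> 'y::metric_space set \<Rightarrow> ('y \<Rightarrow> real) \<Rightarrow> nat \<Rightarrow> 'y set" where
  "cell \<delta> S v j =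
     (if j = 0 then {}
      else if j \<le> num_levels S v then
        {s. (MIN s'\<in>block S v j. dist s s') \<le> \<delta>} - (\<Union>l\<in>{1..<j}. cell \<delta> S v l)
      else UNIV - (\<Union>l\<in>{1..<j}. cell \<delta> S v l))"
  by pat_completeness auto
termination
  by (relation "Wellfounded.measure (\<lambda>(\<delta>, S, v, j). j)") auto

declare cell.simps [simp del]

lemma level_strict_decreasing:
  assumes "finite S" "1 \<le> i" "i < j" "j \<le> num_levels S v"
  shows "level S v j < level S v i"
proof -
  let ?l = "sorted_list_of_set (v ` S)"
  have len: "length ?l = num_levels S v"
    by (simp add: num_levels_def)
  have "?l ! (length ?l - j) < ?l ! (length ?l - i)"
    using assms len by (intro sorted_wrt_nth_less[OF strict_sorted_list_of_set]) auto
  then show ?thesis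
    using assms len by (simp add: level_def rev_nth)
qed

lemma image_level:
  assumes "finite S"
  shows "level S v ` {1..num_levels S v} = v ` S"
proof -
  let ?l = "rev (sorted_list_of_set (v ` S))"
  have "{1..num_levels S v} = Suc ` {..<length ?l}"
    by (simp add: num_levels_def image_Suc_lessThan)
  then have "level S v ` {1..num_levels S v} = (\<lambda>j. ?l ! j) ` {..<length ?l}"
    by (simp only: image_image level_def) simp
  also have "\<dots> = set ?l"
    by (auto simp: set_conv_nth)
  finally show ?thesis
    using assms by simp
qed


type_synonym 'y decision = "real \<times> ('y \<Rightarrow> real) \<times> real"

definition reduced_feasible :: "'y decision set" where
  "reduced_feasible = {(\<beta>, v, \<gamma>). 0 \<le> \<beta> \<and> 0 \<le> \<gamma>}"

definition dual_feasible ::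
    "'y::metric_space measure \<Rightarrow> real \<Rightarrow> (real \<times> ('y \<Rightarrow> real) \<times> ('y \<Rightarrow> real) \<times> real) set" where
  "dual_feasible P \<delta> =
     {(\<beta>, u, v, \<gamma>). 0 \<le> \<beta> \<and> 0 \<le> \<gamma> \<and> u \<in> borel_measurable borel \<and>
        (\<forall>s. \<forall>s'\<in>measure_support P. \<gamma> * of_bool (dist s s' \<le> \<delta>) + v s' \<le> u s)}"

(* v is integrated over the support only, since off the support it is arbitrary and in
   particular need not be measurable. The supremum is taken in ereal and may be \<infinity>. *)
definition dual_objective ::
    "('z \<Rightarrow> 'x \<Rightarrow> real) \<Rightarrow> ('x \<Rightarrow> 'y::metric_space measure) \<Rightarrow> 'y measure \<Rightarrow> real \<Rightarrow> real \<Rightarrow> 'z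
      \<Rightarrow> real \<times> ('y \<Rightarrow> real) \<times> ('y \<Rightarrow> real) \<times> real \<Rightarrow> ereal" where
  "dual_objective loss Obs P \<delta> r z = (\<lambda>(\<beta>, u, v, \<gamma>).
     ereal (\<beta> * r - (LINT s:measure_support P|P. v s) + \<gamma> * (\<delta> - 1))
     + (SUP \<xi>. ereal (loss z \<xi>) + enn2ereal (\<integral>\<^sup>+s. scaled_exp \<beta> (u s) \<partial>Obs \<xi>)))"

definition dual_value ::
    "('z \<Rightarrow> 'x \<Rightarrow> real) \<Rightarrow> ('x \<Rightarrow> 'y::metric_space measure) \<Rightarrow> 'y measure \<Rightarrow> real \<Rightarrow> real \<Rightarrow> 'z \<Rightarrow> ereal"
  where
  "dual_value loss Obs P \<delta> r z = (INF p\<in>dual_feasible P \<delta>. dual_objective loss Obs P \<delta> r z p)"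

definition reduced_objective ::
    "('z \<Rightarrow> 'x \<Rightarrow> real) \<Rightarrow> ('x \<Rightarrow> 'y::metric_space measure) \<Rightarrow> 'y measure \<Rightarrow> real \<Rightarrow> real \<Rightarrow> 'z
      \<Rightarrow> 'y decision \<Rightarrow> ereal" where
  "reduced_objective loss Obs P \<delta> r z = (\<lambda>(\<beta>, v, \<gamma>).
     let S = measure_support P; J = num_levels S v in
     ereal (\<beta> * r - (\<Sum>j=1..J. level S v j * measure P (block S v j)) + \<gamma> * (\<delta> - 1))
     + (SUP \<xi>. ereal (loss z \<xi>) + enn2ereal
         ((\<Sum>j=1..J. emeasure (Obs \<xi>) (cell \<delta> S v j)
                      * scaled_exp \<beta> (max (level S v 1) (level S v j + \<gamma>)))
          + emeasure (Obs \<xi>) (cell \<delta> S v (J + 1)) * scaled_exp \<beta> (level S v 1))))"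

definition reduced_value ::
    "('z \<Rightarrow> 'x \<Rightarrow> real) \<Rightarrow> ('x \<Rightarrow> 'y::metric_space measure) \<Rightarrow> 'y measure \<Rightarrow> real \<Rightarrow> real \<Rightarrow> 'z \<Rightarrow> ereal"
  where
  "reduced_value loss Obs P \<delta> r z = (INF p\<in>reduced_feasible. reduced_objective loss Obs P \<delta> r z p)"


(* Convexity in (beta, v, gamma), for extended-real-valued functions; convex_on of the library is
   for real-valued functions on a real_vector type. *)
definition convex_comb :: "real \<Rightarrow> 'y decision \<Rightarrow> real \<Rightarrow> 'y decision \<Rightarrow> 'y decision" where
  "convex_comb a p b q = (case (p, q) of ((\<beta>, v, \<gamma>), (\<beta>', v', \<gamma>')) \<Rightarrow>
     (a * \<beta> + b * \<beta>', \<lambda>s. a * v s + b * v' s, a * \<gamma> + b * \<gamma>'))"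

definition convex_problem :: "'y decision set \<Rightarrow> ('y decision \<Rightarrow> ereal) \<Rightarrow> bool" where
  "convex_problem F f \<longleftrightarrow>
     (\<forall>p\<in>F. \<forall>q\<in>F. \<forall>a\<ge>0. \<forall>b\<ge>0. a + b = 1 \<longrightarrow>
        convex_comb a p b q \<in> F \<and>
        f (convex_comb a p b q) \<le> ereal a * f p + ereal b * f q)"

end

theory Submission
  imports Defs
begin

text \<open>For fixed \<open>\<beta>\<close>, \<open>v\<close>, \<open>\<gamma>\<close> the dual objective is monotone in \<open>u\<close>, because \<open>scaled_exp \<beta>\<close> is
  monotone also at \<open>\<beta> = 0\<close>. The constraints bound \<open>u\<close> from below pointwise, and since the support
  \<open>S\<close> of the empirical measure is finite and nonempty, there is a least feasible \<open>u\<close>,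
  whose value at \<open>s\<close> is the maximum over \<open>s' \<in> S\<close> of \<open>v s'\<close>, raised by \<open>\<gamma>\<close> if \<open>dist s s' \<le> \<delta>\<close>. It is
  called \<open>envelope\<close> below; it is Borel. Eliminating \<open>u\<close> therefore costs nothing.

  The reduced objective is the dual objective at this \<open>u\<close>. The cells partition the event space
  by the index of the highest level of \<open>v\<close> on \<open>S\<close> that occurs within distance \<open>\<delta>\<close>. On the \<open>j\<close>-th cell
  the points of \<open>S\<close> close to \<open>s\<close> contribute at most \<open>v\<^sub>j + \<gamma>\<close>, with equality for some of them, the
  others at most \<open>v\<^sub>1\<close>, and a maximizer of \<open>v\<close> contributes at least \<open>v\<^sub>1\<close>; so the envelope is constant there, equal to
  \<open>max v\<^sub>1 (v\<^sub>j + \<gamma>)\<close>, and it is \<open>v\<^sub>1\<close> on the remaining cell (\<open>envelope_on_cell\<close>). Its integral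
  is the finite sum in the reduced problem (\<open>nn_integral_envelope\<close>).

  Convexity is invisible in the reduced form, whose partition depends on \<open>v\<close>, but clear in the
  other one: the envelope is a maximum of functions that are linear in \<open>(v, \<gamma>)\<close>, and
  \<open>scaled_exp\<close> is the closed perspective of the convex function \<open>a \<mapsto> exp (a - 1)\<close>, hence jointly
  convex (\<open>scaled_exp_convex\<close>) and monotone in its second argument. Integrals, suprema and
  the addition of a linear term preserve convexity.\<close>

section \<open>The scaled exponential\<close>

lemma scaled_exp_mono:
  assumes "0 \<le> \<beta>" "a \<le> b"
  shows "scaled_exp \<beta> a \<le> scaled_exp \<beta> b"
  using assms by (auto simp: scaled_exp_def intro!: ennreal_leI mult_left_mono divide_right_mono)

lemma measurable_scaled_exp [measurable]: "scaled_exp \<beta> \<in> borel_measurable borel"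
  unfolding scaled_exp_def[abs_def] by measurable

text \<open>Convexity of the perspective: dividing by the total weight \<open>p * \<beta> + q * \<beta>'\<close> turns the claim
  into convexity of \<open>exp\<close> between \<open>a / \<beta> - 1\<close> and \<open>a' / \<beta>' - 1\<close>.\<close>

lemma perspective_exp_convex:
  fixes \<beta> \<beta>' p q a a' :: real
  assumes "0 < \<beta>" "0 < \<beta>'" "0 < p" "0 < q"
  shows "(p * \<beta> + q * \<beta>') * exp ((p * a + q * a') / (p * \<beta> + q * \<beta>') - 1)
    \<le> p * (\<beta> * exp (a / \<beta> - 1)) + q * (\<beta>' * exp (a' / \<beta>' - 1))"
proof -
  define w where "w = p * \<beta> + q * \<beta>'"
  have w: "w > 0"
    using assms by (simp add: w_def add_pos_pos)
  have weights: "p * \<beta> / w + q * \<beta>' / w = 1"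
    using w by (simp add: w_def flip: add_divide_distrib)
  have "(p * a + q * a') / w = (p * \<beta> / w) * (a / \<beta>) + (q * \<beta>' / w) * (a' / \<beta>')"
    using assms by (simp add: add_divide_distrib)
  then have arg: "(p * a + q * a') / w - 1
      = (p * \<beta> / w) * (a / \<beta> - 1) + (q * \<beta>' / w) * (a' / \<beta>' - 1)"
    using weights by (simp add: right_diff_distrib)
  have "exp ((p * a + q * a') / w - 1)
      \<le> (p * \<beta> / w) * exp (a / \<beta> - 1) + (q * \<beta>' / w) * exp (a' / \<beta>' - 1)"
  proof -
    have "1 - q * \<beta>' / w = p * \<beta> / w"
      using weights by simp
    moreover have "0 \<le> q * \<beta>' / w" "q * \<beta>' / w \<le> 1"
      using assms w by (simp_all add: w_def)
    ultimately show ?thesis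
      unfolding arg
      using convex_onD[OF exp_convex, of "q * \<beta>' / w" "a / \<beta> - 1" "a' / \<beta>' - 1"] by simp
  qed
  then have "w * exp ((p * a + q * a') / w - 1)
      \<le> w * ((p * \<beta> / w) * exp (a / \<beta> - 1) + (q * \<beta>' / w) * exp (a' / \<beta>' - 1))"
    using w by (intro mult_left_mono) auto
  also have "\<dots> = p * (\<beta> * exp (a / \<beta> - 1)) + q * (\<beta>' * exp (a' / \<beta>' - 1))"
    using w by (simp add: distrib_left)
  finally show ?thesis
    by (simp add: w_def)
qed

text \<open>The case \<open>\<beta> = 0\<close> of joint convexity. A point with \<open>a > 0\<close> has value \<open>\<infinity>\<close>; with \<open>a \<le> 0\<close> it only
  lowers the exponent.\<close>

lemma scaled_exp_convex_zero:
  assumes "0 \<le> \<beta>'" "0 < p" "0 < q"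
  shows "scaled_exp (q * \<beta>') (p * a + q * a')
    \<le> ennreal p * scaled_exp 0 a + ennreal q * scaled_exp \<beta>' a'"
proof (cases "a \<le> 0")
  case False
  then have "ennreal p * scaled_exp 0 a = \<infinity>"
    using assms by (simp add: scaled_exp_def ennreal_mult_top)
  then show ?thesis
    by simp
next
  case True
  have "scaled_exp (q * \<beta>') (p * a + q * a') \<le> scaled_exp (q * \<beta>') (q * a')"
    using True assms by (intro scaled_exp_mono) (auto simp: mult_nonneg_nonpos)
  also have "\<dots> = ennreal q * scaled_exp \<beta>' a'"
    using assms
    by (auto simp: scaled_exp_def ennreal_mult_top mult_le_0_iff mult.assoc simp flip: ennreal_mult)
  finally show ?thesis
    using True by (simp add: scaled_exp_def)
qed

lemma scaled_exp_convex:
  assumes "0 \<le> \<beta>" "0 \<le> \<beta>'" "0 \<le> p" "0 \<le> q" "p + q = 1"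
  shows "scaled_exp (p * \<beta> + q * \<beta>') (p * a + q * a')
    \<le> ennreal p * scaled_exp \<beta> a + ennreal q * scaled_exp \<beta>' a'"
proof -
  consider "p = 0" | "q = 0" | "0 < p" "0 < q" "\<beta> = 0" | "0 < p" "0 < q" "\<beta>' = 0"
    | "0 < p" "0 < q" "0 < \<beta>" "0 < \<beta>'"
    using assms by force
  then show ?thesis
  proof cases
    case 3
    then show ?thesis
      using scaled_exp_convex_zero[of \<beta>' p q a a'] assms by simp
  next
    case 4
    then show ?thesis
      using scaled_exp_convex_zero[of \<beta> q p a' a] assms by (simp add: add.commute)
  next
    case 5
    then have "p * \<beta> + q * \<beta>' > 0"
      by (simp add: add_pos_pos)
    then show ?thesis
      using 5 perspective_exp_convex[of \<beta> \<beta>' p q a a']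
      by (auto simp: scaled_exp_def simp flip: ennreal_mult ennreal_plus intro!: ennreal_leI)
  qed (use assms in auto)
qed

section \<open>The least feasible potential\<close>

definition envelope :: "real \<Rightarrow> 'y::metric_space set \<Rightarrow> ('y \<Rightarrow> real) \<Rightarrow> real \<Rightarrow> 'y \<Rightarrow> real" where
  "envelope \<delta> S v \<gamma> s = (MAX s'\<in>S. \<gamma> * of_bool (dist s s' \<le> \<delta>) + v s')"

lemma envelope_le_iff:
  assumes "finite S" "S \<noteq> {}"
  shows "envelope \<delta> S v \<gamma> s \<le> c \<longleftrightarrow> (\<forall>s'\<in>S. \<gamma> * of_bool (dist s s' \<le> \<delta>) + v s' \<le> c)"
  using assms by (simp add: envelope_def)

lemma envelope_ge:
  assumes "finite S" "s' \<in> S"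
  shows "\<gamma> * of_bool (dist s s' \<le> \<delta>) + v s' \<le> envelope \<delta> S v \<gamma> s"
  using envelope_le_iff[of S \<delta> v \<gamma> s "envelope \<delta> S v \<gamma> s"] assms by blast

lemma measurable_envelope:
  fixes S :: "'y::metric_space set"
  assumes "finite S"
  shows "envelope \<delta> S v \<gamma> \<in> borel_measurable borel"
proof -
  have [measurable]: "(\<lambda>s::'y. dist s s') \<in> borel_measurable borel" for s'
    by (intro borel_measurable_continuous_onI continuous_intros)
  show ?thesis
    unfolding envelope_def[abs_def] using assms by (intro borel_measurable_Max) auto
qed

lemma envelope_convex:
  assumes S: "finite S" "S \<noteq> {}" and "0 \<le> p" "0 \<le> q"
  shows "envelope \<delta> S (\<lambda>s. p * v s + q * v' s) (p * \<gamma> + q * \<gamma>') s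
    \<le> p * envelope \<delta> S v \<gamma> s + q * envelope \<delta> S v' \<gamma>' s"
proof (subst envelope_le_iff[OF S], intro ballI)
  fix s' assume "s' \<in> S"
  then have "p * (\<gamma> * of_bool (dist s s' \<le> \<delta>) + v s') + q * (\<gamma>' * of_bool (dist s s' \<le> \<delta>) + v' s')
      \<le> p * envelope \<delta> S v \<gamma> s + q * envelope \<delta> S v' \<gamma>' s"
    using assms by (intro add_mono mult_left_mono envelope_ge) auto
  then show "(p * \<gamma> + q * \<gamma>') * of_bool (dist s s' \<le> \<delta>) + (p * v s' + q * v' s')
      \<le> p * envelope \<delta> S v \<gamma> s + q * envelope \<delta> S v' \<gamma>' s"
    by (simp add: algebra_simps)
qed

lemma dual_feasible_iff_envelope_le:
  assumes "finite (measure_support P)" "measure_support P \<noteq> {}"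
  shows "(\<beta>, u, v, \<gamma>) \<in> dual_feasible P \<delta> \<longleftrightarrow> (\<beta>, v, \<gamma>) \<in> reduced_feasible
    \<and> u \<in> borel_measurable borel \<and> (\<forall>s. envelope \<delta> (measure_support P) v \<gamma> s \<le> u s)"
  using assms by (auto simp: dual_feasible_def reduced_feasible_def envelope_le_iff)

lemma dual_objective_mono:
  assumes "0 \<le> \<beta>" "\<And>s. u s \<le> u' s"
  shows "dual_objective loss Obs P \<delta> r z (\<beta>, u, v, \<gamma>) \<le> dual_objective loss Obs P \<delta> r z (\<beta>, u', v, \<gamma>)"
  unfolding dual_objective_def prod.case
  using assms
  by (intro add_left_mono SUP_mono')
     (auto simp: less_eq_ennreal.rep_eq[symmetric] intro!: nn_integral_mono scaled_exp_mono)

lemma dual_value_eq_INF_envelope: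
  assumes S: "finite (measure_support P)" "measure_support P \<noteq> {}"
  shows "dual_value loss Obs P \<delta> r z = (INF (\<beta>, v, \<gamma>)\<in>reduced_feasible.
    dual_objective loss Obs P \<delta> r z (\<beta>, envelope \<delta> (measure_support P) v \<gamma>, v, \<gamma>))"
  unfolding dual_value_def
proof (rule antisym)
  show "(INF p\<in>dual_feasible P \<delta>. dual_objective loss Obs P \<delta> r z p)
      \<le> (INF (\<beta>, v, \<gamma>)\<in>reduced_feasible.
        dual_objective loss Obs P \<delta> r z (\<beta>, envelope \<delta> (measure_support P) v \<gamma>, v, \<gamma>))"
    by (rule INF_greatest)
       (auto intro!: INF_lower simp: dual_feasible_iff_envelope_le[OF S] measurable_envelope[OF S(1)])
next
  show "(INF (\<beta>, v, \<gamma>)\<in>reduced_feasible.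
        dual_objective loss Obs P \<delta> r z (\<beta>, envelope \<delta> (measure_support P) v \<gamma>, v, \<gamma>))
      \<le> (INF p\<in>dual_feasible P \<delta>. dual_objective loss Obs P \<delta> r z p)"
  proof (rule INF_greatest)
    fix p assume p: "p \<in> dual_feasible P \<delta>"
    obtain \<beta> u v \<gamma> where "p = (\<beta>, u, v, \<gamma>)"
      by (cases p)
    with p show "(INF (\<beta>, v, \<gamma>)\<in>reduced_feasible.
        dual_objective loss Obs P \<delta> r z (\<beta>, envelope \<delta> (measure_support P) v \<gamma>, v, \<gamma>))
      \<le> dual_objective loss Obs P \<delta> r z p"
      by (intro INF_lower2[of "(\<beta>, v, \<gamma>)"])
         (auto simp: dual_feasible_iff_envelope_le[OF S] reduced_feasible_def intro!: dual_objective_mono)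
  qed
qed

section \<open>The cells are the level sets of the envelope\<close>

lemma exists_in_block:
  assumes "finite S" "j \<in> {1..num_levels S v}"
  shows "\<exists>s\<in>S. v s = level S v j"
proof -
  have "level S v j \<in> v ` S"
    unfolding image_level[OF assms(1), symmetric] using assms(2) by (rule imageI)
  then show ?thesis
    by auto
qed

lemma block_nonempty:
  assumes "finite S" "j \<in> {1..num_levels S v}"
  shows "block S v j \<noteq> {}"
  using exists_in_block[OF assms] by (auto simp: block_def)

lemma level_mono:
  assumes "finite S" "1 \<le> i" "i \<le> j" "j \<le> num_levels S v"
  shows "level S v j \<le> level S v i"
  using level_strict_decreasing[of S i j v] assms by (cases "i = j") auto

lemma exists_block_index:
  assumes "finite S" "s \<in> S"
  shows "\<exists>j\<in>{1..num_levels S v}. s \<in> block S v j"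
proof -
  have "v s \<in> level S v ` {1..num_levels S v}"
    unfolding image_level[OF assms(1)] using assms(2) by (rule imageI)
  then show ?thesis
    using assms(2) by (auto simp: block_def)
qed

lemma disjoint_family_on_block:
  assumes "finite S"
  shows "disjoint_family_on (block S v) {1..num_levels S v}"
  unfolding disjoint_family_on_def
proof (intro ballI impI)
  fix i j assume "i \<in> {1..num_levels S v}" "j \<in> {1..num_levels S v}" "i \<noteq> j"
  then have "level S v i \<noteq> level S v j"
    using level_strict_decreasing[OF assms, of i j v] level_strict_decreasing[OF assms, of j i v]
    by (cases i j rule: linorder_cases) auto
  then show "block S v i \<inter> block S v j = {}"
    by (auto simp: block_def)
qed

definition near :: "real \<Rightarrow> 'y::metric_space set \<Rightarrow> 'y set" where
  "near \<delta> B = (\<Union>s'\<in>B. cball s' \<delta>)"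

lemma Min_dist_le_iff_near:
  assumes "finite B" "B \<noteq> {}"
  shows "{s. (MIN s'\<in>B. dist s s') \<le> \<delta>} = near \<delta> B"
  using assms by (auto simp: near_def Min_le_iff dist_commute)

text \<open>The definition of the cells is recursive only because each cell removes its predecessors;
  together they exhaust the neighbourhoods of the first \<open>j - 1\<close> blocks.\<close>

lemma Union_cell:
  assumes "finite S" "j \<le> num_levels S v + 1"
  shows "(\<Union>l\<in>{1..<j}. cell \<delta> S v l) = (\<Union>l\<in>{1..<j}. near \<delta> (block S v l))"
  using assms(2)
proof (induction j)
  case (Suc j)
  show ?case
  proof (cases "j = 0")
    case False
    then have "cell \<delta> S v j = near \<delta> (block S v j) - (\<Union>l\<in>{1..<j}. cell \<delta> S v l)"
      using Suc.prems assms(1) block_nonempty[of S j v]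
      by (subst cell.simps) (simp add: Min_dist_le_iff_near block_def)
    moreover have "{1..<Suc j} = insert j {1..<j}"
      using False by auto
    ultimately show ?thesis
      using Suc by auto
  qed auto
qed auto

lemma cell_eq_near:
  assumes "finite S" "j \<in> {1..num_levels S v}"
  shows "cell \<delta> S v j = near \<delta> (block S v j) - (\<Union>l\<in>{1..<j}. near \<delta> (block S v l))"
  using assms block_nonempty[of S j v] Union_cell[of S j v \<delta>]
  by (subst cell.simps) (simp add: Min_dist_le_iff_near block_def)

lemma last_cell_eq_near:
  assumes "finite S"
  shows "cell \<delta> S v (num_levels S v + 1) = - (\<Union>l\<in>{1..num_levels S v}. near \<delta> (block S v l))"
  using assms Union_cell[of S "num_levels S v + 1" v \<delta>]
  by (subst cell.simps) (auto simp: atLeastLessThanSuc_atLeastAtMost)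

lemma cell_in_borel:
  assumes "finite S" "j \<in> {1..num_levels S v + 1}"
  shows "cell \<delta> S v j \<in> sets borel"
proof -
  have [measurable]: "near \<delta> (block S v l) \<in> sets borel" for l
    unfolding near_def using assms(1)
    by (intro borel_closed closed_UN) (auto simp: block_def)
  show ?thesis
  proof (cases "j = num_levels S v + 1")
    case True
    show ?thesis
      unfolding True last_cell_eq_near[OF assms(1)]
      by (intro borel_comp sets.finite_UN) auto
  next
    case False
    then show ?thesis
      using assms(2) by (subst cell_eq_near[OF assms(1)]) auto
  qed
qed

lemma disjoint_family_on_cell:
  assumes "finite S"
  shows "disjoint_family_on (cell \<delta> S v) {1..num_levels S v + 1}"
  unfolding disjoint_family_on_def
proof (intro ballI impI)
  have less: "cell \<delta> S v i \<inter> cell \<delta> S v j = {}"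
    if "1 \<le> i" "i < j" "j \<le> num_levels S v + 1" for i j
  proof -
    have "cell \<delta> S v i \<subseteq> near \<delta> (block S v i)"
      using that by (subst cell_eq_near[OF assms]) auto
    moreover have "cell \<delta> S v j \<inter> near \<delta> (block S v i) = {}"
      using that assms cell_eq_near[of S j v \<delta>] last_cell_eq_near[of S \<delta> v]
      by (cases "j = num_levels S v + 1") auto
    ultimately show ?thesis
      by blast
  qed
  fix i j assume "i \<in> {1..num_levels S v + 1}" "j \<in> {1..num_levels S v + 1}" "i \<noteq> j"
  then show "cell \<delta> S v i \<inter> cell \<delta> S v j = {}"
    using less[of i j] less[of j i] by (cases i j rule: linorder_cases) auto
qed

lemma cells_cover:
  assumes "finite S"
  shows "\<exists>j\<in>{1..num_levels S v + 1}. s \<in> cell \<delta> S v j"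
proof (cases "s \<in> cell \<delta> S v (num_levels S v + 1)")
  case False
  then have "s \<in> (\<Union>l\<in>{1..<num_levels S v + 1}. cell \<delta> S v l)"
    using assms last_cell_eq_near[of S \<delta> v] Union_cell[of S "num_levels S v + 1" v \<delta>]
    by (simp add: atLeastLessThanSuc_atLeastAtMost)
  then show ?thesis
    by force
qed auto

definition cell_value :: "'y set \<Rightarrow> ('y \<Rightarrow> real) \<Rightarrow> real \<Rightarrow> nat \<Rightarrow> real" where
  "cell_value S v \<gamma> j =
    (if j \<le> num_levels S v then max (level S v 1) (level S v j + \<gamma>) else level S v 1)"

text \<open>A point of \<open>S\<close> in the block \<open>i\<close> that is close to \<open>s\<close> has \<open>i \<ge> j\<close>, so it contributes at most
  the value of the block \<open>j\<close> plus \<open>\<gamma>\<close>. The envelope is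
  never below the top level of \<open>v\<close>, because \<open>\<gamma>\<close> is nonnegative.\<close>

lemma envelope_on_cell:
  assumes S: "finite S" "S \<noteq> {}" and "0 \<le> \<gamma>"
    and j: "j \<in> {1..num_levels S v + 1}" and s: "s \<in> cell \<delta> S v j"
  shows "envelope \<delta> S v \<gamma> s = cell_value S v \<gamma> j"
proof (rule antisym)
  have far: "s \<notin> near \<delta> (block S v i)" if "i < j" "i \<in> {1..num_levels S v}" for i
    using that s j S cell_eq_near[of S j v \<delta>] last_cell_eq_near[of S \<delta> v]
    by (cases "j = num_levels S v + 1") auto
  show "envelope \<delta> S v \<gamma> s \<le> cell_value S v \<gamma> j"
  proof (subst envelope_le_iff[OF S], intro ballI)
    fix s' assume "s' \<in> S"
    then obtain i where i: "i \<in> {1..num_levels S v}" "s' \<in> block S v i"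
      using exists_block_index[OF S(1)] by blast
    then have v: "v s' = level S v i"
      by (simp add: block_def)
    show "\<gamma> * of_bool (dist s s' \<le> \<delta>) + v s' \<le> cell_value S v \<gamma> j"
    proof (cases "dist s s' \<le> \<delta>")
      case True
      then have "s \<in> near \<delta> (block S v i)"
        using i by (auto simp: near_def dist_commute)
      then have "j \<le> i"
        using far[of i] i by force
      then show ?thesis
        using True i j v level_mono[of S j i v] S by (auto simp: cell_value_def)
    next
      case False
      then show ?thesis
        using i v level_mono[of S 1 i v] S by (auto simp: cell_value_def)
    qed
  qed
  have "num_levels S v \<ge> 1"
    using S by (simp add: num_levels_def Suc_le_eq card_gt_0_iff)
  then obtain s1 where "s1 \<in> S" "v s1 = level S v 1"
    using exists_in_block[of S 1 v] S by auto
  then have "level S v 1 \<le> envelope \<delta> S v \<gamma> s"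
    using envelope_ge[of S s1 \<gamma> s \<delta> v] S \<open>0 \<le> \<gamma>\<close> by (cases "dist s s1 \<le> \<delta>") auto
  moreover have "level S v j + \<gamma> \<le> envelope \<delta> S v \<gamma> s" if "j \<le> num_levels S v"
  proof -
    have "s \<in> near \<delta> (block S v j)"
      using s cell_eq_near[of S j v \<delta>] that j S by simp
    then obtain s' where "s' \<in> S" "v s' = level S v j" "dist s s' \<le> \<delta>"
      by (auto simp: near_def block_def dist_commute)
    then show ?thesis
      using envelope_ge[of S s' \<gamma> s \<delta> v] S by simp
  qed
  ultimately show "cell_value S v \<gamma> j \<le> envelope \<delta> S v \<gamma> s"
    by (simp add: cell_value_def)
qed

lemma nn_integral_envelope:
  assumes S: "finite S" "S \<noteq> {}" and "0 \<le> \<gamma>" and M: "sets M = sets borel"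
  shows "(\<integral>\<^sup>+s. f (envelope \<delta> S v \<gamma> s) \<partial>M)
    = (\<Sum>j=1..num_levels S v. emeasure M (cell \<delta> S v j) * f (max (level S v 1) (level S v j + \<gamma>)))
      + emeasure M (cell \<delta> S v (num_levels S v + 1)) * f (level S v 1)"
proof -
  let ?J = "num_levels S v"
  have "f (envelope \<delta> S v \<gamma> s)
      = (\<Sum>j=1..?J+1. f (cell_value S v \<gamma> j) * indicator (cell \<delta> S v j) s)" for s
  proof -
    obtain j where j: "j \<in> {1..?J+1}" "s \<in> cell \<delta> S v j"
      using cells_cover[OF S(1)] by blast
    have "indicator (cell \<delta> S v i) s = (of_bool (i = j) :: ennreal)" if "i \<in> {1..?J+1}" for i
      using that j disjoint_family_onD[OF disjoint_family_on_cell[OF S(1)], of i v j \<delta>]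
      by (auto simp: indicator_def)
    then have "(\<Sum>i=1..?J+1. f (cell_value S v \<gamma> i) * indicator (cell \<delta> S v i) s)
        = (\<Sum>i=1..?J+1. if i = j then f (cell_value S v \<gamma> i) else 0)"
      by (intro sum.cong) auto
    also have "\<dots> = f (cell_value S v \<gamma> j)"
      using j(1) by (subst sum.delta) auto
    finally show ?thesis
      using envelope_on_cell[OF S \<open>0 \<le> \<gamma>\<close> j] by simp
  qed
  then have "(\<integral>\<^sup>+s. f (envelope \<delta> S v \<gamma> s) \<partial>M)
      = (\<integral>\<^sup>+s. (\<Sum>j=1..?J+1. f (cell_value S v \<gamma> j) * indicator (cell \<delta> S v j) s) \<partial>M)"
    by simp
  also have "\<dots> = (\<Sum>j=1..?J+1. f (cell_value S v \<gamma> j) * emeasure M (cell \<delta> S v j))"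
  proof -
    have cell: "cell \<delta> S v j \<in> sets M" if "j \<in> {1..?J+1}" for j
      using cell_in_borel[OF S(1) that] M by simp
    then show ?thesis
      by (subst nn_integral_sum, force)
         (intro sum.cong refl nn_integral_cmult_indicator cell)
  qed
  also have "\<dots> = (\<Sum>j=1..?J. emeasure M (cell \<delta> S v j) * f (cell_value S v \<gamma> j))
      + emeasure M (cell \<delta> S v (?J + 1)) * f (cell_value S v \<gamma> (?J + 1))"
    by (simp add: mult.commute)
  also have "\<dots> = (\<Sum>j=1..?J. emeasure M (cell \<delta> S v j) * f (max (level S v 1) (level S v j + \<gamma>)))
      + emeasure M (cell \<delta> S v (?J + 1)) * f (level S v 1)"
    by (simp add: cell_value_def)
  finally show ?thesis .
qed

section \<open>The reduced objective is the dual objective at the envelope\<close>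

text \<open>Off the finite set \<open>S\<close> the integrand vanishes, so it is a simple function for every
  function \<open>v\<close>.\<close>

lemma set_integral_finite_set:
  fixes v :: "'y::t1_space \<Rightarrow> real"
  assumes "finite_measure M" "sets M = sets borel" "finite S"
  shows "(LINT s:S|M. v s) = (\<Sum>s\<in>S. v s * measure M {s})"
proof -
  interpret finite_measure M by fact
  have [measurable]: "{s} \<in> sets M" for s
    using assms(2) by simp
  have "(LINT s:S|M. v s) = (LINT s|M. (\<Sum>s'\<in>S. v s' * indicator {s'} s))"
    unfolding set_lebesgue_integral_def
    using assms(3) by (intro Bochner_Integration.integral_cong) (auto simp: indicator_def sum.delta')
  also have "\<dots> = (\<Sum>s\<in>S. v s * measure M {s})"
    by (subst Bochner_Integration.integral_sum) (auto simp: less_top[symmetric] emeasure_eq_measure)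
  finally show ?thesis .
qed

lemma sum_by_levels:
  fixes v :: "'y::t1_space \<Rightarrow> real"
  assumes "finite_measure M" "sets M = sets borel" "finite S"
  shows "(\<Sum>j=1..num_levels S v. level S v j * measure M (block S v j))
    = (\<Sum>s\<in>S. v s * measure M {s})"
proof -
  interpret finite_measure M by fact
  have S: "S = (\<Union>j\<in>{1..num_levels S v}. block S v j)"
    using exists_block_index[OF assms(3)] by (auto simp: block_def)
  have fin: "finite (block S v j)" for j
    using assms(3) by (simp add: block_def)
  have "(\<Sum>s\<in>S. v s * measure M {s})
      = (\<Sum>j=1..num_levels S v. \<Sum>s\<in>block S v j. v s * measure M {s})"
    using disjoint_family_on_block[OF assms(3), of v] fin
    by (subst S, intro sum.UNION_disjoint) (auto simp: disjoint_family_on_def)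
  also have "\<dots> = (\<Sum>j=1..num_levels S v. level S v j * (\<Sum>s\<in>block S v j. measure M {s}))"
    by (simp add: sum_distrib_left block_def)
  also have "\<dots> = (\<Sum>j=1..num_levels S v. level S v j * measure M (block S v j))"
    using fin assms(2) by (subst finite_measure_eq_sum_singleton) auto
  finally show ?thesis ..
qed

lemma reduced_objective_eq_dual_objective:
  assumes P: "finite_measure P" "sets P = sets borel"
    and S: "finite (measure_support P)" "measure_support P \<noteq> {}"
    and Obs: "\<And>\<xi>. sets (Obs \<xi>) = sets borel"
    and feasible: "(\<beta>, v, \<gamma>) \<in> reduced_feasible"
  shows "reduced_objective loss Obs P \<delta> r z (\<beta>, v, \<gamma>)
    = dual_objective loss Obs P \<delta> r z (\<beta>, envelope \<delta> (measure_support P) v \<gamma>, v, \<gamma>)"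
  using feasible
  by (simp add: reduced_objective_def dual_objective_def Let_def reduced_feasible_def
      nn_integral_envelope[OF S _ Obs] sum_by_levels[OF P S(1), unfolded One_nat_def]
      set_integral_finite_set[OF P S(1)])

section \<open>Convexity\<close>

lemma ereal_distrib_left_real:
  "ereal a * (ereal c + X) = ereal (a * c) + ereal a * X"
  by (cases X) (auto simp: distrib_left)

lemma dual_objective_envelope_convex:
  fixes P :: "'y::metric_space measure"
  assumes P: "finite_measure P" "sets P = sets borel"
    and S: "finite (measure_support P)" "measure_support P \<noteq> {}"
    and Obs: "\<And>\<xi>. sets (Obs \<xi>) = sets borel"
    and nonneg: "0 \<le> \<beta>" "0 \<le> \<beta>'" and weights: "0 \<le> a" "0 \<le> b" "a + b = 1"
  defines "S \<equiv> measure_support P"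
  shows "dual_objective loss Obs P \<delta> r z
      (a * \<beta> + b * \<beta>', envelope \<delta> S (\<lambda>s. a * v s + b * v' s) (a * \<gamma> + b * \<gamma>'),
        \<lambda>s. a * v s + b * v' s, a * \<gamma> + b * \<gamma>')
    \<le> ereal a * dual_objective loss Obs P \<delta> r z (\<beta>, envelope \<delta> S v \<gamma>, v, \<gamma>)
      + ereal b * dual_objective loss Obs P \<delta> r z (\<beta>', envelope \<delta> S v' \<gamma>', v', \<gamma>')"
proof -
  define I where "I \<beta> v \<gamma> \<xi> = (\<integral>\<^sup>+s. scaled_exp \<beta> (envelope \<delta> S v \<gamma> s) \<partial>Obs \<xi>)" for \<beta> v \<gamma> \<xi>
  define F where "F \<beta> v \<gamma> \<xi> = ereal (loss z \<xi>) + enn2ereal (I \<beta> v \<gamma> \<xi>)" for \<beta> v \<gamma> \<xi>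
  define c where "c \<beta> v \<gamma> = \<beta> * r - (\<Sum>s\<in>S. v s * measure P {s}) + \<gamma> * (\<delta> - 1)" for \<beta> v \<gamma>
  let ?\<beta> = "a * \<beta> + b * \<beta>'" and ?v = "\<lambda>s. a * v s + b * v' s" and ?\<gamma> = "a * \<gamma> + b * \<gamma>'"
  have objective: "dual_objective loss Obs P \<delta> r z (\<beta>, envelope \<delta> S v \<gamma>, v, \<gamma>)
      = ereal (c \<beta> v \<gamma>) + (SUP \<xi>. F \<beta> v \<gamma> \<xi>)" for \<beta> v \<gamma>
    using set_integral_finite_set[OF P S(1)]
    by (simp add: dual_objective_def c_def F_def I_def S_def)
  have c: "c ?\<beta> ?v ?\<gamma> = a * c \<beta> v \<gamma> + b * c \<beta>' v' \<gamma>'"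
    by (simp add: c_def algebra_simps sum.distrib sum_distrib_left)
  have measurable: "(\<lambda>s. scaled_exp \<beta> (envelope \<delta> S v \<gamma> s)) \<in> borel_measurable (Obs \<xi>)" for \<beta> v \<gamma> \<xi>
    using measurable_compose[OF measurable_envelope[OF S(1)] measurable_scaled_exp]
    by (simp add: measurable_cong_sets[OF Obs] S_def)
  have I: "I ?\<beta> ?v ?\<gamma> \<xi> \<le> ennreal a * I \<beta> v \<gamma> \<xi> + ennreal b * I \<beta>' v' \<gamma>' \<xi>" for \<xi>
  proof -
    have "I ?\<beta> ?v ?\<gamma> \<xi> \<le> (\<integral>\<^sup>+s. scaled_exp ?\<beta> (a * envelope \<delta> S v \<gamma> s + b * envelope \<delta> S v' \<gamma>' s) \<partial>Obs \<xi>)"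
      unfolding I_def S_def using S nonneg weights
      by (intro nn_integral_mono scaled_exp_mono envelope_convex) auto
    also have "\<dots> \<le> (\<integral>\<^sup>+s. ennreal a * scaled_exp \<beta> (envelope \<delta> S v \<gamma> s)
        + ennreal b * scaled_exp \<beta>' (envelope \<delta> S v' \<gamma>' s) \<partial>Obs \<xi>)"
      using nonneg weights by (intro nn_integral_mono scaled_exp_convex) auto
    also have "\<dots> = ennreal a * I \<beta> v \<gamma> \<xi> + ennreal b * I \<beta>' v' \<gamma>' \<xi>"
      unfolding I_def using measurable by (simp add: nn_integral_add nn_integral_cmult)
    finally show ?thesis .
  qed
  have "F ?\<beta> ?v ?\<gamma> \<xi> \<le> ereal a * (SUP \<xi>. F \<beta> v \<gamma> \<xi>) + ereal b * (SUP \<xi>. F \<beta>' v' \<gamma>' \<xi>)" for \<xi>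
  proof -
    have "enn2ereal (I ?\<beta> ?v ?\<gamma> \<xi>)
        \<le> ereal a * enn2ereal (I \<beta> v \<gamma> \<xi>) + ereal b * enn2ereal (I \<beta>' v' \<gamma>' \<xi>)"
      using I[of \<xi>] weights
      by (simp add: less_eq_ennreal.rep_eq plus_ennreal.rep_eq times_ennreal.rep_eq)
    moreover have "ereal (loss z \<xi>) = ereal (a * loss z \<xi>) + ereal (b * loss z \<xi>)"
      using weights(3) by (simp flip: distrib_right)
    ultimately have "F ?\<beta> ?v ?\<gamma> \<xi> \<le> (ereal (a * loss z \<xi>) + ereal (b * loss z \<xi>))
        + (ereal a * enn2ereal (I \<beta> v \<gamma> \<xi>) + ereal b * enn2ereal (I \<beta>' v' \<gamma>' \<xi>))"
      unfolding F_def by (metis add_left_mono)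
    also have "\<dots> = ereal a * F \<beta> v \<gamma> \<xi> + ereal b * F \<beta>' v' \<gamma>' \<xi>"
      unfolding F_def ereal_distrib_left_real by (simp only: add_ac)
    also have "\<dots> \<le> ereal a * (SUP \<xi>. F \<beta> v \<gamma> \<xi>) + ereal b * (SUP \<xi>. F \<beta>' v' \<gamma>' \<xi>)"
      using weights by (intro add_mono ereal_mult_left_mono SUP_upper) auto
    finally show ?thesis .
  qed
  then have "(SUP \<xi>. F ?\<beta> ?v ?\<gamma> \<xi>) \<le> ereal a * (SUP \<xi>. F \<beta> v \<gamma> \<xi>) + ereal b * (SUP \<xi>. F \<beta>' v' \<gamma>' \<xi>)"
    by (rule SUP_least)
  then have "ereal (c ?\<beta> ?v ?\<gamma>) + (SUP \<xi>. F ?\<beta> ?v ?\<gamma> \<xi>)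
      \<le> (ereal (a * c \<beta> v \<gamma>) + ereal (b * c \<beta>' v' \<gamma>'))
        + (ereal a * (SUP \<xi>. F \<beta> v \<gamma> \<xi>) + ereal b * (SUP \<xi>. F \<beta>' v' \<gamma>' \<xi>))"
    unfolding c plus_ereal.simps(1) by (rule add_left_mono)
  also have "\<dots> = ereal a * (ereal (c \<beta> v \<gamma>) + (SUP \<xi>. F \<beta> v \<gamma> \<xi>))
      + ereal b * (ereal (c \<beta>' v' \<gamma>') + (SUP \<xi>. F \<beta>' v' \<gamma>' \<xi>))"
    unfolding ereal_distrib_left_real by (simp only: add_ac)
  finally show ?thesis
    unfolding objective .
qed

lemma finite_measure_empirical_measure:
  assumes "N \<ge> 1"
  shows "finite_measure (empirical_measure N xi)"
proof (rule finite_measureI)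
  have "space (empirical_measure N xi) = UNIV"
    by (simp add: empirical_measure_def space_measure_of_conv)
  moreover have "emeasure (empirical_measure N xi) UNIV \<noteq> \<infinity>"
    using assms by (subst emeasure_empirical_measure) (auto simp: ennreal_divide_eq_top_iff)
  ultimately show "emeasure (empirical_measure N xi) (space (empirical_measure N xi)) \<noteq> \<infinity>"
    by simp
qed

lemma sets_empirical_measure: "sets (empirical_measure N xi) = sets borel"
  using sets.sigma_sets_eq[of "borel :: 'a measure"] by (simp add: empirical_measure_def)

theorem lemma3p5:
  fixes loss :: "'z \<Rightarrow> 'x::polish_space \<Rightarrow> real"
    and Obs :: "'x \<Rightarrow> 'y::{metric_space, second_countable_topology} measure"
    and xi :: "nat \<Rightarrow> 'y" and N :: nat
    and P :: "'y measure"
    and \<delta> r :: real and z :: 'z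
  assumes polish: "completely_metrizable_space (euclidean :: 'y topology)"
    and kernel: "Obs \<in> borel \<rightarrow>\<^sub>M prob_algebra borel"
    and N: "N \<ge> 1"
    and P: "P = empirical_measure N xi"
    and \<delta>: "\<delta> > 0"
    and r: "r > 0"
  shows "dual_value loss Obs P \<delta> r z = reduced_value loss Obs P \<delta> r z
    \<and> convex_problem reduced_feasible (reduced_objective loss Obs P \<delta> r z)"
proof
  have P': "finite_measure P" "sets P = sets borel"
    unfolding P using N by (simp_all add: finite_measure_empirical_measure sets_empirical_measure)
  have S: "finite (measure_support P)" "measure_support P \<noteq> {}"
    unfolding P measure_support_empirical_measure using N by auto
  have Obs: "sets (Obs \<xi>) = sets borel" for \<xi>
    using measurable_space[OF kernel, of \<xi>] by (simp add: space_prob_algebra)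
  note reduced_eq = reduced_objective_eq_dual_objective[OF P' S Obs]
  show "dual_value loss Obs P \<delta> r z = reduced_value loss Obs P \<delta> r z"
    unfolding dual_value_eq_INF_envelope[OF S] reduced_value_def
    by (intro INF_cong) (auto simp: reduced_eq)
  show "convex_problem reduced_feasible (reduced_objective loss Obs P \<delta> r z)"
    unfolding convex_problem_def
  proof (intro ballI allI impI)
    fix p q :: "'y decision" and a b :: real
    assume "p \<in> reduced_feasible" "q \<in> reduced_feasible" and ab: "0 \<le> a" "0 \<le> b" "a + b = 1"
    moreover obtain \<beta> v \<gamma> where p: "p = (\<beta>, v, \<gamma>)"
      by (cases p)
    moreover obtain \<beta>' v' \<gamma>' where q: "q = (\<beta>', v', \<gamma>')"
      by (cases q)
    ultimately have nonneg: "0 \<le> \<beta>" "0 \<le> \<beta>'"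
      and feasible: "(\<beta>, v, \<gamma>) \<in> reduced_feasible" "(\<beta>', v', \<gamma>') \<in> reduced_feasible"
        "(a * \<beta> + b * \<beta>', \<lambda>s. a * v s + b * v' s, a * \<gamma> + b * \<gamma>') \<in> reduced_feasible"
      by (auto simp: reduced_feasible_def)
    show "convex_comb a p b q \<in> reduced_feasible \<and> reduced_objective loss Obs P \<delta> r z (convex_comb a p b q)
        \<le> ereal a * reduced_objective loss Obs P \<delta> r z p + ereal b * reduced_objective loss Obs P \<delta> r z q"
      using feasible dual_objective_envelope_convex[OF P' S Obs nonneg ab]
      by (simp add: p q convex_comb_def reduced_eq)
  qed
qed

end
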